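(* Let $p_1=0,p_2,\dots,p_n\in\mathbb R^d$ represent a point in $C_n(\mathbb R^d)$, and let $P$ denote the $d\times(n-1)$ matrix with columns $p_2,\dots,p_n$. Then the Gram matrix $A(p)$ of the configuration is given by $A(p)={}^tP\cdot P$, and consequently $A(p)$ is positive semi-definite of rank at most $d$. Conversely, if $A$ is a non-zero real symmetric $(n-1)\times(n-1)$ matrix which is positive semi-definite of rank at most $d$, there is a configuration $p_1=0,p_2,\dots,p_n\in\mathbb R^d$ (with at least two distinct points) such that $A=A(p)$.
   Context: $C_n(\mathbb R^d)$ is the set of $n$-tuples of points of $\mathbb R^d$, with at least two of them distinct, modulo isometries and rescaling; here $d\le n-1$. For a configuration with $p_1=0$, the Gram matrix $A(p)=(a_{ij}(p))_{2\le i,j\le n}$ has entries $a_{ij}(p)=\langle p_i-p_1,p_j-p_1\rangle=\langle p_i,p_j\rangle$, with $\langle\ ,\ \rangle$ the usual inner product in $\mathbb R^d$. *)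

theory Defs
  imports "HOL-Analysis.Analysis"
begin

text \<open>
  A tuple of points of \<open>\<real>\<^sup>d\<close> is a function from a finite type of labels to \<open>real ^ 'd\<close>.
\<close>

definition configurations :: "('i::finite \<Rightarrow> real ^ 'd) set" where
  "configurations = {p. \<exists>i j. p i \<noteq> p j}"

definition isometry :: "('a::metric_space \<Rightarrow> 'a) \<Rightarrow> bool" where
  "isometry f \<longleftrightarrow> bij f \<and> (\<forall>x y. dist (f x) (f y) = dist x y)"

definition similar_rel :: "(('i::finite \<Rightarrow> real ^ 'd) \<times> ('i \<Rightarrow> real ^ 'd)) set" where
  "similar_rel = {(p, q). p \<in> configurations \<and> q \<in> configurations \<and>
     (\<exists>f c. isometry f \<and> c > 0 \<and> (\<forall>i. q i = c *\<^sub>R f (p i)))}"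

lemma dist_scaleR_scaleR: "dist (c *\<^sub>R x) (c *\<^sub>R y) = \<bar>c\<bar> * dist x y"
  for x y :: "'a::real_normed_vector"
  by (metis dist_norm norm_scaleR scaleR_diff_right)

lemma equiv_similar_rel: "equiv configurations similar_rel"
proof (rule equivI)
  show "similar_rel \<subseteq> configurations \<times> configurations"
    by (auto simp: similar_rel_def)
  show "refl_on configurations similar_rel"
  proof (rule refl_onI)
    fix p :: "'i::finite \<Rightarrow> real ^ 'd" assume "p \<in> configurations"
    moreover have "isometry (id :: real ^ 'd \<Rightarrow> real ^ 'd)" by (simp add: isometry_def)
    moreover have "\<forall>i. p i = 1 *\<^sub>R id (p i)" by simp
    ultimately show "(p, p) \<in> similar_rel"
      unfolding similar_rel_def using zero_less_one by blast
  qed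
  show "sym similar_rel"
  proof (rule symI)
    fix p q :: "'i::finite \<Rightarrow> real ^ 'd" assume "(p, q) \<in> similar_rel"
    then obtain f c where pq: "p \<in> configurations" "q \<in> configurations"
      and f: "isometry f" "c > 0" "\<And>i. q i = c *\<^sub>R f (p i)"
      by (auto simp: similar_rel_def)
    define g where "g = (\<lambda>x. c *\<^sub>R inv f ((1 / c) *\<^sub>R x))"
    have bf: "bij f" and df: "\<And>x y. dist (f x) (f y) = dist x y"
      using f(1) by (auto simp: isometry_def)
    have di: "dist (inv f x) (inv f y) = dist x y" for x y
      using df[of "inv f x" "inv f y"] bf by (simp add: bij_is_surj surj_f_inv_f)
    have "g (c *\<^sub>R f ((1 / c) *\<^sub>R x)) = x" "c *\<^sub>R f ((1 / c) *\<^sub>R g x) = x" for x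
      using \<open>c > 0\<close> bf by (simp_all add: g_def bij_is_inj bij_is_surj surj_f_inv_f)
    then have "bij g" by (intro o_bij[of "\<lambda>x. c *\<^sub>R f ((1 / c) *\<^sub>R x)"]) (auto simp: fun_eq_iff)
    moreover have "dist (g x) (g y) = dist x y" for x y
      using \<open>c > 0\<close> by (simp add: g_def dist_scaleR_scaleR di)
    ultimately have "isometry g" by (simp add: isometry_def)
    moreover have "\<forall>i. p i = (1 / c) *\<^sub>R g (q i)"
      using f bf by (simp add: g_def bij_is_inj)
    ultimately show "(q, p) \<in> similar_rel"
      unfolding similar_rel_def using pq \<open>c > 0\<close> by (auto intro!: exI[of _ g] exI[of _ "1 / c"])
  qed
  show "trans similar_rel"
  proof (rule transI)
    fix p q r :: "'i::finite \<Rightarrow> real ^ 'd"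
    assume "(p, q) \<in> similar_rel" "(q, r) \<in> similar_rel"
    then obtain f c g e where pr: "p \<in> configurations" "r \<in> configurations"
      and f: "isometry f" "c > 0" "\<And>i. q i = c *\<^sub>R f (p i)"
      and g: "isometry g" "e > 0" "\<And>i. r i = e *\<^sub>R g (q i)"
      by (auto simp: similar_rel_def)
    define h where "h = (\<lambda>x. (1 / c) *\<^sub>R g (c *\<^sub>R f x))"
    have bf: "bij f" and bg: "bij g" using f g by (auto simp: isometry_def)
    have "inv f ((1 / c) *\<^sub>R inv g (c *\<^sub>R h x)) = x" "h (inv f ((1 / c) *\<^sub>R inv g (c *\<^sub>R x))) = x" for x
      using \<open>c > 0\<close> bf bg by (simp_all add: h_def bij_is_inj bij_is_surj surj_f_inv_f)
    then have "bij h"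
      by (intro o_bij[of "\<lambda>x. inv f ((1 / c) *\<^sub>R inv g (c *\<^sub>R x))"]) (auto simp: fun_eq_iff)
    moreover have "dist (h x) (h y) = dist x y" for x y
      using f g by (simp add: h_def isometry_def dist_scaleR_scaleR)
    ultimately have "isometry h" by (simp add: isometry_def)
    moreover have "\<forall>i. r i = (e * c) *\<^sub>R h (p i)"
      using f g by (simp add: h_def)
    ultimately show "(p, r) \<in> similar_rel"
      unfolding similar_rel_def using pr f g by (auto intro!: exI[of _ h] exI[of _ "e * c"])
  qed
qed

text \<open>
  \<open>C\<^sub>n(\<real>\<^sup>d)\<close> with \<open>n = CARD('i)\<close> and \<open>d = CARD('d)\<close>; its points are equivalence classes of tuples,
  and the tuples representing a point are the elements of the class.
\<close>

definition configuration_space :: "('i::finite \<Rightarrow> real ^ 'd) set set" where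
  "configuration_space = configurations // similar_rel"

text \<open>
  To single out the first point, the labels \<open>1, 2, \<dots>, n\<close> are the elements of \<open>'m option\<close>, where
  \<open>CARD('m) = n - 1\<close>: \<open>None\<close> is the label \<open>1\<close>, and \<open>Some i\<close> for \<open>i :: 'm\<close> are the labels
  \<open>2, \<dots>, n\<close>. Thus matrices with rows and columns indexed by \<open>2, \<dots>, n\<close> have type \<open>real ^ 'm ^ 'm\<close>.
\<close>

definition gram_matrix :: "('m::finite option \<Rightarrow> real ^ 'd) \<Rightarrow> real ^ 'm ^ 'm" where
  "gram_matrix p = (\<chi> i j. (p (Some i) - p None) \<bullet> (p (Some j) - p None))"

definition point_matrix :: "('m::finite option \<Rightarrow> real ^ 'd) \<Rightarrow> real ^ 'm ^ 'd" where
  "point_matrix p = (\<chi> k j. p (Some j) $ k)"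

definition positive_semidefinite :: "real ^ 'm ^ 'm \<Rightarrow> bool" where
  "positive_semidefinite A \<longleftrightarrow> transpose A = A \<and> (\<forall>x. 0 \<le> x \<bullet> (A *v x))"

end

theory Submission
  imports Defs
begin

text \<open>
  If \<open>p\<^sub>1 = 0\<close>, the Gram matrix is by definition the product of the transpose of \<open>P\<close> with \<open>P\<close>.
  Its quadratic form at \<open>x\<close> is \<open>P x \<bullet> P x\<close>, and its rank is at most the number \<open>d\<close> of rows
  of \<open>P\<close>.

  For the converse, being a Gram matrix of vectors in \<open>\<real>\<^sup>d\<close> means being a sum of \<open>d\<close> matrices
  of the form \<open>w\<close> times the transpose of \<open>w\<close>: the vectors \<open>w\<close> are the rows of \<open>P\<close>. Such a
  decomposition is obtained without diagonalizing \<open>A\<close>, by completing squares as in the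
  reduction of a quadratic form to a sum of squares. If \<open>A \<noteq> 0\<close>, there is an \<open>x\<close> with
  \<open>c = x \<bullet> A x > 0\<close>. With \<open>u = A x\<close>, subtract from the form the square of the linear form
  \<open>y \<mapsto> (u \<bullet> y) / sqrt c\<close>. What remains at \<open>y\<close> is the value of the old form at the projection
  of \<open>y\<close> along \<open>x\<close> to the \<open>A\<close>-orthogonal complement of \<open>x\<close>, hence is still nonnegative
  (\<open>positive_semidefinite_deflate\<close>). The rank drops, because the range of the new matrix lies in
  the range of \<open>A\<close> but is orthogonal to \<open>x\<close>, while \<open>A x\<close> is not (\<open>rank_deflate_less\<close>). So
  at most as many squares as the rank of \<open>A\<close> are needed
  (\<open>positive_semidefinite_sum_of_squares\<close>).
\<close>

lemma positive_semidefinite_transpose_mult: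
  fixes P :: "real ^ 'm ^ 'd"
  shows "positive_semidefinite (transpose P ** P)"
proof -
  have "x \<bullet> ((transpose P ** P) *v x) = (P *v x) \<bullet> (P *v x)" for x
    by (metis dot_lmul_matrix matrix_vector_mul_assoc vector_transpose_matrix transpose_transpose)
  then show ?thesis
    by (simp add: positive_semidefinite_def matrix_transpose_mul)
qed

lemma symmetric_matrix_inner:
  fixes A :: "real ^ 'm ^ 'm"
  assumes "transpose A = A"
  shows "x \<bullet> (A *v y) = (A *v x) \<bullet> y"
  by (metis assms dot_lmul_matrix transpose_matrix_vector)

lemma quadratic_form_add:
  fixes A :: "real ^ 'm ^ 'm"
  assumes "transpose A = A"
  shows "(x + y) \<bullet> (A *v (x + y)) = x \<bullet> (A *v x) + 2 * (y \<bullet> (A *v x)) + y \<bullet> (A *v y)"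
  using symmetric_matrix_inner[OF assms, of x y]
  by (simp add: matrix_vector_right_distrib inner_add_left inner_add_right inner_commute)

text \<open>
  By polarization, a symmetric matrix whose quadratic form vanishes is zero. The test vector
  \<open>A x\<close> turns the vanishing of the bilinear form into \<open>A x = 0\<close>.
\<close>

lemma positive_semidefinite_nonzero_imp_pos:
  fixes A :: "real ^ 'm ^ 'm"
  assumes "positive_semidefinite A" "A \<noteq> 0"
  obtains x where "x \<bullet> (A *v x) > 0"
proof (rule ccontr)
  assume "\<not> thesis"
  with that assms(1) have zero: "x \<bullet> (A *v x) = 0" for x
    unfolding positive_semidefinite_def by (metis less_eq_real_def)
  have "A *v x = 0" for x
    using quadratic_form_add[of A x "A *v x"] assms(1) zero
    by (simp add: positive_semidefinite_def)
  then show False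
    using assms(2) by (simp add: matrix_eq)
qed

text \<open>
  The matrix of the form \<open>A\<close> after removal of the square that belongs to \<open>x\<close>. If
  \<open>x \<bullet> A x \<noteq> 0\<close>, it is the Schur complement taken along \<open>x\<close> instead of along a coordinate
  vector, but extended by zero along \<open>x\<close> so that its size stays the same.
\<close>

definition deflate :: "real ^ 'm ^ 'm \<Rightarrow> real ^ 'm \<Rightarrow> real ^ 'm ^ 'm" where
  "deflate A x = (\<chi> i j. A $ i $ j - (A *v x) $ i * (A *v x) $ j / (x \<bullet> (A *v x)))"

lemma deflate_mult_vec:
  "deflate A x *v y = A *v y - (((A *v x) \<bullet> y) / (x \<bullet> (A *v x))) *\<^sub>R (A *v x)"
proof -
  define u c where "u = A *v x" and "c = x \<bullet> u"
  have "(deflate A x *v y) $ i = (A *v y - ((u \<bullet> y) / c) *\<^sub>R u) $ i" for i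
    unfolding deflate_def u_def[symmetric] c_def[symmetric]
    by (simp add: matrix_vector_mult_def inner_vec_def sum_subtractf
        sum_divide_distrib sum_distrib_left algebra_simps)
  then show ?thesis
    by (simp add: vec_eq_iff u_def c_def)
qed

lemma transpose_deflate: "transpose A = A \<Longrightarrow> transpose (deflate A x) = deflate A x"
  by (simp add: deflate_def transpose_def vec_eq_iff mult.commute)

text \<open>
  The vector \<open>y + t x\<close> with \<open>t = - (A x \<bullet> y) / (x \<bullet> A x)\<close> is the component of \<open>y\<close> that is
  \<open>A\<close>-orthogonal to \<open>x\<close>; the deflated form at \<open>y\<close> is the form of \<open>A\<close> at this component.
\<close>

lemma positive_semidefinite_deflate:
  fixes A :: "real ^ 'm ^ 'm"
  assumes "positive_semidefinite A" "x \<bullet> (A *v x) > 0"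
  shows "positive_semidefinite (deflate A x)"
proof -
  have sym: "transpose A = A" and nonneg: "0 \<le> z \<bullet> (A *v z)" for z
    using assms(1) by (auto simp: positive_semidefinite_def)
  have "0 \<le> y \<bullet> (deflate A x *v y)" for y
  proof -
    define c where "c = x \<bullet> (A *v x)"
    define b where "b = (A *v x) \<bullet> y"
    have "c \<noteq> 0" using assms(2) by (simp add: c_def)
    have xy: "x \<bullet> (A *v y) = b"
      by (simp add: b_def symmetric_matrix_inner[OF sym])
    define t where "t = - b / c"
    have "(y + t *\<^sub>R x) \<bullet> (A *v (y + t *\<^sub>R x))
        = y \<bullet> (A *v y) + 2 * (t * b) + t * (t * c)"
      by (subst quadratic_form_add[OF sym])
        (simp add: matrix_vector_mult_scaleR xy c_def)
    also have "\<dots> = y \<bullet> (A *v y) - b / c * b"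
      using \<open>c \<noteq> 0\<close> by (simp add: t_def field_simps)
    also have "\<dots> = y \<bullet> (deflate A x *v y)"
      by (simp add: deflate_mult_vec inner_diff_right b_def c_def inner_commute)
    finally show ?thesis
      using nonneg by metis
  qed
  then show ?thesis
    by (simp add: positive_semidefinite_def transpose_deflate sym)
qed

lemma rank_deflate_less:
  fixes A :: "real ^ 'm ^ 'm"
  assumes "transpose A = A" "x \<bullet> (A *v x) \<noteq> 0"
  shows "rank (deflate A x) < rank A"
proof -
  let ?B = "deflate A x"
  have "?B *v y = A *v (y - (((A *v x) \<bullet> y) / (x \<bullet> (A *v x))) *\<^sub>R x)" for y
    by (simp add: deflate_mult_vec matrix_vector_mult_diff_distrib matrix_vector_mult_scaleR)
  then have sub: "range ((*v) ?B) \<subseteq> range ((*v) A)"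
    by auto
  have "?B *v x = 0"
    using assms(2) by (simp add: deflate_mult_vec inner_commute)
  then have "x \<bullet> (?B *v y) = 0" for y
    by (simp add: symmetric_matrix_inner transpose_deflate assms(1))
  then have "A *v x \<notin> range ((*v) ?B)"
    using assms(2) by auto
  with sub have "range ((*v) ?B) \<subset> range ((*v) A)"
    by blast
  moreover have "span (range ((*v) M)) = range ((*v) M)" for M :: "real ^ 'm ^ 'm"
    by (simp add: linear_subspace_image span_eq_iff)
  ultimately show ?thesis
    unfolding rank_dim_range by (intro dim_psubset) (simp only:)
qed

text \<open>
  The summation index ranges over an arbitrary finite set that is large enough: this is what the
  induction needs, each element of the set paying for one deflation, and it leaves room for zero
  summands when the rank is smaller than the number of coordinates.
\<close>

lemma positive_semidefinite_sum_of_squares: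
  fixes A :: "real ^ 'm ^ 'm"
  assumes "finite S" "positive_semidefinite A" "rank A \<le> card S"
  shows "\<exists>w :: 'k \<Rightarrow> real ^ 'm. \<forall>i j. A $ i $ j = (\<Sum>k\<in>S. w k $ i * w k $ j)"
  using assms
proof (induction S arbitrary: A rule: finite_induct)
  case empty
  then have "A = 0"
    by (simp add: rank_eq_0)
  then show ?case by simp
next
  case (insert k S)
  show ?case
  proof (cases "A = 0")
    case True
    then show ?thesis by (intro exI[of _ "\<lambda>_. 0"]) simp
  next
    case False
    then obtain x where x: "x \<bullet> (A *v x) > 0"
      using positive_semidefinite_nonzero_imp_pos insert.prems(1) by blast
    define c where "c = x \<bullet> (A *v x)"
    have "c > 0" using x by (simp add: c_def)
    have "rank (deflate A x) < rank A"
      using x insert.prems(1) by (intro rank_deflate_less) (auto simp: positive_semidefinite_def)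
    then have "rank (deflate A x) \<le> card S"
      using insert.prems(2) insert.hyps by simp
    then obtain w :: "'k \<Rightarrow> real ^ 'm"
      where w: "deflate A x $ i $ j = (\<Sum>k\<in>S. w k $ i * w k $ j)" for i j
      using insert.IH positive_semidefinite_deflate[OF insert.prems(1) x] by blast
    define w' where "w' = w(k := (1 / sqrt c) *\<^sub>R (A *v x))"
    have "A $ i $ j = (\<Sum>l\<in>insert k S. w' l $ i * w' l $ j)" for i j
    proof -
      have "(\<Sum>l\<in>S. w' l $ i * w' l $ j) = (\<Sum>l\<in>S. w l $ i * w l $ j)"
        using insert.hyps by (intro sum.cong) (auto simp: w'_def)
      also have "\<dots> = A $ i $ j - (A *v x) $ i * (A *v x) $ j / c"
        by (simp add: w[symmetric] deflate_def c_def)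
      finally show ?thesis
        using insert.hyps \<open>c > 0\<close> by (simp add: w'_def)
    qed
    then show ?thesis by blast
  qed
qed

lemma gram_matrix_eq_transpose_mult:
  "p None = 0 \<Longrightarrow> gram_matrix p = transpose (point_matrix p) ** point_matrix p"
  by (simp add: gram_matrix_def point_matrix_def matrix_matrix_mult_def transpose_def
      inner_vec_def vec_eq_iff)

lemma gram_matrix_nonzero_imp_configuration:
  "gram_matrix p \<noteq> 0 \<Longrightarrow> p \<in> configurations"
proof (rule ccontr)
  assume "gram_matrix p \<noteq> 0" "p \<notin> configurations"
  then have "p (Some i) = p None" for i
    by (auto simp: configurations_def)
  with \<open>gram_matrix p \<noteq> 0\<close> show False
    by (simp add: gram_matrix_def vec_eq_iff)
qed

lemma positive_semidefinite_is_gram_matrix: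
  fixes A :: "real ^ 'm ^ 'm"
  assumes "positive_semidefinite A" "rank A \<le> CARD('d::finite)"
  obtains p :: "'m option \<Rightarrow> real ^ 'd" where "p None = 0" "A = gram_matrix p"
proof -
  obtain w :: "'d \<Rightarrow> real ^ 'm" where w: "A $ i $ j = (\<Sum>k\<in>UNIV. w k $ i * w k $ j)" for i j
    using positive_semidefinite_sum_of_squares[of "UNIV :: 'd set" A] assms by auto
  \<comment> \<open>The vectors \<open>w k\<close> are the rows of the point matrix; the points are its columns.\<close>
  define p :: "'m option \<Rightarrow> real ^ 'd"
    where "p l = (case l of None \<Rightarrow> 0 | Some j \<Rightarrow> (\<chi> k. w k $ j))" for l
  have "A = gram_matrix p"
    by (simp add: vec_eq_iff gram_matrix_def p_def inner_vec_def w)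
  then show thesis
    using that[of p] by (simp add: p_def)
qed

theorem lemma4p2:
  assumes "CARD('d::finite) \<le> CARD('m::finite option) - 1"
  shows "(\<forall>X \<in> (configuration_space :: ('m option \<Rightarrow> real ^ 'd) set set). \<forall>p \<in> X. p None = 0 \<longrightarrow>
            gram_matrix p = transpose (point_matrix p) ** point_matrix p \<and>
            positive_semidefinite (gram_matrix p) \<and>
            rank (gram_matrix p) \<le> CARD('d)) \<and>
         (\<forall>A :: real ^ 'm ^ 'm.
            A \<noteq> 0 \<and> transpose A = A \<and> positive_semidefinite A \<and> rank A \<le> CARD('d) \<longrightarrow>
            (\<exists>p :: 'm option \<Rightarrow> real ^ 'd. p \<in> configurations \<and> p None = 0 \<and> A = gram_matrix p))"
proof (intro conjI ballI allI impI)
  fix p :: "'m option \<Rightarrow> real ^ 'd"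
  assume "p None = 0"
  then show eq: "gram_matrix p = transpose (point_matrix p) ** point_matrix p"
    by (rule gram_matrix_eq_transpose_mult)
  show "positive_semidefinite (gram_matrix p)"
    unfolding eq by (rule positive_semidefinite_transpose_mult)
  have "rank (gram_matrix p) \<le> rank (point_matrix p)"
    unfolding eq by (rule rank_mul_le_right)
  also have "\<dots> \<le> CARD('d)"
    using rank_bound[of "point_matrix p"] by simp
  finally show "rank (gram_matrix p) \<le> CARD('d)" .
next
  fix A :: "real ^ 'm ^ 'm"
  assume A: "A \<noteq> 0 \<and> transpose A = A \<and> positive_semidefinite A \<and> rank A \<le> CARD('d)"
  then obtain p :: "'m option \<Rightarrow> real ^ 'd" where "p None = 0" "A = gram_matrix p"
    using positive_semidefinite_is_gram_matrix by blast
  with A show "\<exists>p :: 'm option \<Rightarrow> real ^ 'd. p \<in> configurations \<and> p None = 0 \<and> A = gram_matrix p"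
    using gram_matrix_nonzero_imp_configuration by blast
qed

end
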